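(* Fix any integers $k\leq n$. Then any NFA $M$ with $L(M)=L_k(n)$ has at least $2^k$ states.
   Context: For integers $k\leq n$, $L_k(n)\subseteq [n]^k$ is the set of words $w_1\cdots w_k\in[n]^k$ such that $w_1,\ldots,w_k$ are all distinct. An NFA over alphabet $[n]$ is a nondeterministic finite automaton (a directed graph of states with transitions labeled by elements of $[n]$, a start state and a set of accepting states); $L(M)$ is the set of words labeling a path from the start state to an accepting state. *)

theory Defs
  imports Main
begin

record ('s, 'a) nfa =
  states :: "'s set"
  transitions :: "('s \<times> 'a \<times> 's) set"
  start :: 's
  accepting :: "'s set"

text \<open>There is a single start state and there are no empty-word transitions.\<close>

definition is_nfa :: "'a set \<Rightarrow> ('s, 'a) nfa \<Rightarrow> bool" where
  "is_nfa A M \<longleftrightarrow>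
     finite (states M) \<and>
     transitions M \<subseteq> states M \<times> A \<times> states M \<and>
     start M \<in> states M \<and>
     accepting M \<subseteq> states M"

inductive nfa_path :: "('s, 'a) nfa \<Rightarrow> 's \<Rightarrow> 'a list \<Rightarrow> 's \<Rightarrow> bool"
  for M :: "('s, 'a) nfa" where
  Nil: "p \<in> states M \<Longrightarrow> nfa_path M p [] p"
| Cons: "(p, a, q) \<in> transitions M \<Longrightarrow> nfa_path M q w r \<Longrightarrow> nfa_path M p (a # w) r"

definition nfa_language :: "('s, 'a) nfa \<Rightarrow> 'a list set" where
  "nfa_language M = {w. \<exists>q \<in> accepting M. nfa_path M (start M) w q}"

definition distinct_words :: "nat \<Rightarrow> nat \<Rightarrow> nat list set" where
  "distinct_words k n = {w. length w = k \<and> set w \<subseteq> {1..n} \<and> distinct w}"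

end

(* Fooling set argument: for each S \<subseteq> {1..k}, a word listing S followed by a word listing its
   complement is accepted; let q S be the state reached in between. If q S = q T, crossing the two
   runs gives an accepted word listing S and then {1..k} - T, so these sets are disjoint, and
   S \<subseteq> T. By symmetry q is injective on the 2^k subsets. *)
theory Submission
  imports Defs
begin

lemma nfa_path_append:
  assumes "nfa_path M p u q" "nfa_path M q v r"
  shows "nfa_path M p (u @ v) r"
  using assms by induction (auto intro: nfa_path.intros)

lemma nfa_path_source_in_states:
  assumes "is_nfa A M" "nfa_path M p w r"
  shows "p \<in> states M"
  using assms(2,1) by cases (auto simp: is_nfa_def)

text \<open>Induction on the prefix \<open>u\<close>. For empty \<open>u\<close> the splitting state
  is \<open>p\<close> itself, and \<open>is_nfa\<close> supplies the membership in
  \<open>states M\<close> that the rule \<open>nfa_path.Nil\<close> demands.\<close>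

lemma nfa_path_appendE:
  assumes "is_nfa A M" "nfa_path M p (u @ v) r"
  obtains q where "q \<in> states M" "nfa_path M p u q" "nfa_path M q v r"
proof -
  have "\<exists>q\<in>states M. nfa_path M p u q \<and> nfa_path M q v r"
    using assms(2)
  proof (induction u arbitrary: p)
    case Nil
    then show ?case
      using nfa_path_source_in_states[OF assms(1)] nfa_path.Nil by fastforce
  next
    case (Cons a u)
    from Cons.prems obtain p' where "(p, a, p') \<in> transitions M" "nfa_path M p' (u @ v) r"
      by (auto elim: nfa_path.cases)
    with Cons.IH show ?case
      by (blast intro: nfa_path.Cons)
  qed
  with that show thesis by blast
qed

theorem theorem4p2:
  fixes k n :: nat and M :: "('s, nat) nfa"
  assumes "k \<le> n"
    and "is_nfa {1..n} M"
    and "nfa_language M = distinct_words k n"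
  shows "2 ^ k \<le> card (states M)"
proof -
  define word where "word S = sorted_list_of_set S" for S :: "nat set"
  define mid where "mid S q \<longleftrightarrow> q \<in> states M \<and> nfa_path M (start M) (word S) q \<and>
    (\<exists>r\<in>accepting M. nfa_path M q (word ({1..k} - S)) r)" for S q
  have "\<exists>q. mid S q" if S: "S \<in> Pow {1..k}" for S
  proof -
    from S have "finite S"
      by (auto intro: finite_subset)
    \<comment> \<open>With this bound the truncated subtraction in
      \<open>card S + (k - card S)\<close>, the length of the concatenated word, gives exactly
      \<open>k\<close>.\<close>
    moreover from S have "card S \<le> k"
      using card_mono[of "{1..k}" S] by simp
    ultimately have "word S @ word ({1..k} - S) \<in> distinct_words k n"
      using S \<open>k \<le> n\<close> by (auto simp: distinct_words_def word_def card_Diff_subset)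
    then obtain r where r: "r \<in> accepting M" "nfa_path M (start M) (word S @ word ({1..k} - S)) r"
      unfolding assms(3)[symmetric] nfa_language_def by blast
    from nfa_path_appendE[OF assms(2) r(2)] r(1) show ?thesis
      unfolding mid_def by metis
  qed
  then obtain q where q: "\<And>S. S \<in> Pow {1..k} \<Longrightarrow> mid S (q S)"
    by metis
  have crossing: "S \<subseteq> T" if "S \<in> Pow {1..k}" "T \<in> Pow {1..k}" "q S = q T" for S T
  proof -
    \<comment> \<open>The first half of the run for \<open>S\<close> is continued by the second half
      of the run for \<open>T\<close> through the common state \<open>q S = q T\<close>.\<close>
    have "word S @ word ({1..k} - T) \<in> nfa_language M"
      using q[OF that(1)] q[OF that(2)] that(3) nfa_path_append
      unfolding mid_def nfa_language_def by fastforce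
    then have "distinct (word S @ word ({1..k} - T))"
      unfolding assms(3) distinct_words_def by blast
    \<comment> \<open>Finiteness matters because \<open>sorted_list_of_set\<close> defaults to the
      empty list on infinite sets; here \<open>set (word S) = S\<close>, so distinctness makes
      \<open>S\<close> disjoint from \<open>{1..k} - T\<close>.\<close>
    moreover from that(1) have "finite S"
      by (auto intro: finite_subset)
    ultimately show ?thesis
      using that(1) by (auto simp: word_def)
  qed
  have "inj_on q (Pow {1..k})"
    by (intro inj_onI subset_antisym crossing) auto
  moreover have "q ` Pow {1..k} \<subseteq> states M"
    using q by (auto simp: mid_def)
  moreover have "finite (states M)"
    using assms(2) by (simp add: is_nfa_def)
  ultimately have "card (Pow {1..k}) \<le> card (states M)"
    by (rule card_inj_on_le)
  then show ?thesis
    by (simp add: card_Pow)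
qed

end
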